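(* For all $n\ge1$ the squared norms satisfy $$\begin{aligned}\mathcal{H}_{n+2}=(A-1)^{-2}\Big(&\big(-[J,\mathcal{H}_nJ\mathcal{H}_n^{-1}]-\mathcal{H}_n(A^t-1)\mathcal{H}_{n-1}^{-1}(A-1)+(A-1)\mathcal{H}_{n+1}(A^t-1)\mathcal{H}_n^{-1}\big)(A-1)\\&-2-\mathcal{H}_{n+1}J\mathcal{H}_{n+1}^{-1}+\mathcal{H}_nJ\mathcal{H}_n^{-1}+(A-1)[J,\mathcal{H}_{n+1}J\mathcal{H}_{n+1}^{-1}]\\&+(A-1)\mathcal{H}_{n+1}(A^t-1)\mathcal{H}_n^{-1}(A-1)\Big)\mathcal{H}_{n+1}(A^t-1)^{-1}.\end{aligned}$$ Moreover, for $1\le i,j\le N$, $$(\mathcal{H}_0)_{i,j}=\Gamma(\nu)\sum_{r=1}^{\min\{i,j\}}\frac{\delta_r^{(\nu)}}{(i-r)!\,(j-r)!}\Big(\prod_{k=r}^{i-1}a_k\Big)\Big(\prod_{s=r}^{j-1}a_s\Big)(\nu)_{i+j-r+1},$$ where $\Gamma(\cdot)$ is the Gamma function and $(\nu)_m=\nu(\nu+1)\cdots(\nu+m-1)$.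
   Context: Let $N\ge1$, $\nu>0$, let $a_1,\dots,a_{N-1}$ be real, let $E_{i,j}$ be the matrix units, and put $J=\sum_{k=1}^NkE_{k,k}$, $A=\sum_{k=1}^{N-1}a_kE_{k+1,k}$. Let $\delta_1^{(\nu)},\dots,\delta_N^{(\nu)}>0$ and $$W^{(\nu)}(x)=e^{Ax}\,T^{(\nu)}(x)\,e^{A^*x},\qquad T^{(\nu)}(x)=e^{-x}\sum_{k=1}^N\delta_k^{(\nu)}x^{\nu+k}E_{k,k},\qquad x\in[0,\infty).$$ Let $(P(x,n))_{n\ge0}$ be the unique sequence of monic polynomials of degree $n$ in $M_N(\mathbb{C})[x]$ with $\int_0^\infty P(x,n)W^{(\nu)}(x)P(x,m)^*\,dx=\delta_{n,m}\mathcal{H}_n$. $A^t$ is the transpose, $[\cdot,\cdot]$ the matrix commutator, and scalars denote multiples of the identity matrix; empty products equal $1$. *)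

theory Defs
  imports "HOL-Analysis.Analysis" "HOL-Computational_Algebra.Polynomial"
begin

text \<open>
  An $N \times N$ complex matrix is an element of \<open>complex ^ 'n ^ 'n\<close>. The rows and columns are
  numbered $1, \dots, N$ by an enumeration \<open>e\<close> of the index type with
  \<open>bij_betw e {1..N} UNIV\<close>, so that the $(i,j)$ entry of \<open>M\<close> is \<open>M $ e i $ e j\<close>.
\<close>

definition matrix_unit :: "(nat \<Rightarrow> 'n) \<Rightarrow> nat \<Rightarrow> nat \<Rightarrow> complex ^ 'n ^ 'n" where
  "matrix_unit e i j = (\<chi> p q. if p = e i \<and> q = e j then 1 else 0)"

definition ctranspose :: "complex ^ 'n ^ 'm \<Rightarrow> complex ^ 'm ^ 'n" where
  "ctranspose M = (\<chi> i j. cnj (M $ j $ i))"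

definition commutator :: "complex ^ 'n ^ 'n \<Rightarrow> complex ^ 'n ^ 'n \<Rightarrow> complex ^ 'n ^ 'n" where
  "commutator X Y = X ** Y - Y ** X"

primrec matrix_power :: "complex ^ 'n ^ 'n \<Rightarrow> nat \<Rightarrow> complex ^ 'n ^ 'n" where
  "matrix_power M 0 = mat 1"
| "matrix_power M (Suc k) = M ** matrix_power M k"

text \<open>The type \<open>complex ^ 'n ^ 'n\<close> is not an instance of the classes required by \<open>exp\<close>.\<close>

definition matrix_exp :: "complex ^ 'n ^ 'n \<Rightarrow> complex ^ 'n ^ 'n" where
  "matrix_exp M = (\<Sum>k. (1 / fact k) *\<^sub>R matrix_power M k)"

definition J_matrix :: "nat \<Rightarrow> (nat \<Rightarrow> 'n) \<Rightarrow> complex ^ 'n ^ 'n" where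
  "J_matrix N e = (\<Sum>k=1..N. real k *\<^sub>R matrix_unit e k k)"

definition A_matrix :: "nat \<Rightarrow> (nat \<Rightarrow> 'n) \<Rightarrow> (nat \<Rightarrow> real) \<Rightarrow> complex ^ 'n ^ 'n" where
  "A_matrix N e a = (\<Sum>k\<in>{1..<N}. a k *\<^sub>R matrix_unit e (k + 1) k)"

definition T_weight ::
  "nat \<Rightarrow> (nat \<Rightarrow> 'n) \<Rightarrow> real \<Rightarrow> (nat \<Rightarrow> real) \<Rightarrow> real \<Rightarrow> complex ^ 'n ^ 'n" where
  "T_weight N e \<nu> \<delta> x =
     exp (- x) *\<^sub>R (\<Sum>k=1..N. (\<delta> k * x powr (\<nu> + real k)) *\<^sub>R matrix_unit e k k)"

definition W_weight ::
  "nat \<Rightarrow> (nat \<Rightarrow> 'n) \<Rightarrow> (nat \<Rightarrow> real) \<Rightarrow> real \<Rightarrow> (nat \<Rightarrow> real) \<Rightarrow> real \<Rightarrow> complex ^ 'n ^ 'n" where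
  "W_weight N e a \<nu> \<delta> x =
     matrix_exp (x *\<^sub>R A_matrix N e a) ** T_weight N e \<nu> \<delta> x **
     matrix_exp (x *\<^sub>R ctranspose (A_matrix N e a))"

text \<open>
  Evaluation of a matrix polynomial at a real point; the library's \<open>poly\<close> requires a
  commutative coefficient semiring.
\<close>

definition matrix_poly :: "(complex ^ 'n ^ 'n) poly \<Rightarrow> real \<Rightarrow> complex ^ 'n ^ 'n" where
  "matrix_poly p x = (\<Sum>k\<le>degree p. (x ^ k) *\<^sub>R coeff p k)"

definition matrix_monic :: "(complex ^ 'n ^ 'n) poly \<Rightarrow> nat \<Rightarrow> bool" where
  "matrix_monic p n \<longleftrightarrow> degree p = n \<and> coeff p n = mat 1"

definition monic_orthogonal ::
  "(real \<Rightarrow> complex ^ 'n ^ 'n) \<Rightarrow> (nat \<Rightarrow> (complex ^ 'n ^ 'n) poly) \<Rightarrow>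
   (nat \<Rightarrow> complex ^ 'n ^ 'n) \<Rightarrow> bool" where
  "monic_orthogonal W P H \<longleftrightarrow>
     (\<forall>n. matrix_monic (P n) n) \<and>
     (\<forall>n m. (LINT x:{0..}|lborel. matrix_poly (P n) x ** W x ** ctranspose (matrix_poly (P m) x))
            = (if n = m then H n else 0))"

end

theory Submission
  imports Defs
begin

text \<open>
  Put \<open>L = A - 1\<close>, \<open>M = A\<^sup>t - 1\<close>, let \<open>\<mu>\<^sub>m\<close> be the \<open>m\<close>-th moment of the weight, and let \<open>X\<^sub>n\<close> be the
  coefficient of degree \<open>n - 1\<close> of \<open>P\<^sub>n\<close>. The weight enters the recursion only through its moments.

  Since \<open>A\<close> is nilpotent, the entries of the weight are combinations of functions \<open>x powr s * exp (- x)\<close>,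
  so the moments have an explicit form with Gamma values; for \<open>m = 0\<close> this is the formula for \<open>H\<^sub>0\<close>.
  The functional equation of Gamma turns into the Pearson relation
  \<open>(m + 1 + \<nu>) \<mu>\<^sub>m + \<mu>\<^sub>m J = - L \<mu>\<^sub>m\<^sub>+\<^sub>1\<close> (\<open>moment_pearson_left\<close>). The moments are symmetric, so the
  transposed relation \<open>(m + 1 + \<nu>) \<mu>\<^sub>m + J \<mu>\<^sub>m = - \<mu>\<^sub>m\<^sub>+\<^sub>1 M\<close> holds too. They are the algebraic
  form of integration by parts.

  Multiplying the first relation by coefficients of \<open>P\<^sub>n\<close> on both sides and summing, orthogonality
  removes all but a few terms and leaves
  \<open>L X\<^sub>n\<^sub>+\<^sub>1 - X\<^sub>n L = 2n + 1 + \<nu> + \<Phi>\<^sub>n\<close>, where \<open>\<Phi>\<^sub>n\<close> is \<open>J\<close> conjugated by \<open>H\<^sub>n\<close> (\<open>subleading_left\<close>). The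
  second relation, paired between \<open>P\<^sub>n\<close> and \<open>P\<^sub>n\<^sub>-\<^sub>1\<close>, gives
  \<open>X\<^sub>n + [J, X\<^sub>n] = K\<^sub>n\<close>, where \<open>K\<^sub>n\<close> is \<open>H\<^sub>n M\<close> times the inverse of \<open>H\<^sub>n\<^sub>-\<^sub>1\<close> (\<open>subleading_right\<close>).
  Because \<open>[J, L] = L + 1\<close>, applying \<open>[J, _]\<close> to the first family of equations allows the \<open>X\<^sub>n\<close> to be
  eliminated (\<open>elimination_identity\<close>). What remains expresses \<open>L\<^sup>2 K\<^sub>n\<^sub>+\<^sub>2\<close>, hence \<open>H\<^sub>n\<^sub>+\<^sub>2\<close>,
  by \<open>H\<^sub>n\<^sub>-\<^sub>1\<close>, \<open>H\<^sub>n\<close> and \<open>H\<^sub>n\<^sub>+\<^sub>1\<close>.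

  The inverses exist because \<open>A\<close> is strictly lower triangular and because \<open>H\<^sub>n\<close> is nonsingular:
  if \<open>w H\<^sub>n = 0\<close> then the row polynomial \<open>w P\<^sub>n\<close> has norm zero for a weight that is positive definite on
  \<open>x > 0\<close>, so it vanishes, and its leading coefficient is \<open>w\<close> (\<open>invertible_weighted_norm\<close>).
\<close>

section \<open>Matrices over the complex numbers\<close>

lemma bounded_bilinear_matrix_mult:
  "bounded_bilinear ((**) :: complex^'n^'n \<Rightarrow> complex^'n^'n \<Rightarrow> complex^'n^'n)"
proof -
  have "bilinear ((**) :: complex^'n^'n \<Rightarrow> complex^'n^'n \<Rightarrow> complex^'n^'n)"
    unfolding bilinear_def linear_iff
    by (auto simp: vec_eq_iff matrix_matrix_mult_def sum.distrib algebra_simps scaleR_sum_right)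
  then show ?thesis by (simp add: bilinear_conv_bounded_bilinear)
qed

text \<open>
  The type of square matrices is not an instance of a ring class, so the laws for sums, differences
  and scalars are taken from the bilinearity of the product.
\<close>

interpretation matmul: bounded_bilinear "(**) :: complex^'n^'n \<Rightarrow> complex^'n^'n \<Rightarrow> complex^'n^'n"
  by (rule bounded_bilinear_matrix_mult)

lemmas matrix_ring_simps =
  matmul.add_left matmul.add_right matmul.diff_left matmul.diff_right
  matmul.minus_left matmul.minus_right matmul.scaleR_left matmul.scaleR_right
  matrix_mul_assoc[symmetric]

lemma linear_ctranspose: "linear (ctranspose :: complex^'n^'m \<Rightarrow> complex^'m^'n)"
  by (rule linearI) (simp_all add: ctranspose_def vec_eq_iff)

lemma ctranspose_mult: "ctranspose (X ** Y) = ctranspose Y ** ctranspose X"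
  by (simp add: ctranspose_def vec_eq_iff matrix_matrix_mult_def mult.commute)

lemma ctranspose_mat_1: "ctranspose (mat 1) = mat 1"
  by (auto simp: ctranspose_def vec_eq_iff mat_def)

lemma invertible_transpose:
  fixes X :: "'a::field^'n^'n"
  shows "invertible (transpose X) \<longleftrightarrow> invertible X"
  by (metis invertible_left_inverse invertible_right_inverse left_invertible_transpose)

lemma matrix_inv_eq:
  fixes X :: "complex^'n^'n"
  assumes "invertible X"
  shows "X ** matrix_inv X = mat 1" "matrix_inv X ** X = mat 1"
  using assms unfolding invertible_def matrix_inv_def by (metis (mono_tags, lifting) someI_ex)+

lemma matrix_power_commute: "matrix_power M k ** M = M ** matrix_power M k"
  by (induction k) (simp_all add: matrix_mul_assoc[symmetric])

lemma matrix_power_ctranspose: "matrix_power (ctranspose M) k = ctranspose (matrix_power M k)"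
  by (induction k) (simp_all add: ctranspose_mat_1 ctranspose_mult[symmetric] matrix_power_commute)

lemma matrix_exp_nilpotent:
  assumes "\<And>k. N \<le> k \<Longrightarrow> matrix_power M k = 0"
  shows "matrix_exp M = (\<Sum>k<N. (1 / fact k) *\<^sub>R matrix_power M k)"
  unfolding matrix_exp_def by (rule suminf_finite) (auto simp: assms)

section \<open>Elimination of the subleading coefficients\<close>

text \<open>
  The first two equations hold for consecutive indices, with constants differing by \<open>2\<close>; subtracting
  them leaves \<open>L (X\<^sub>2 - X\<^sub>3) = (X\<^sub>1 - X\<^sub>2) L - 2 - \<Phi>\<^sub>2 + \<Phi>\<^sub>1\<close>. On the other hand
  \<open>X\<^sub>1 - X\<^sub>2 = - [J, \<Phi>\<^sub>1] + L K\<^sub>2 - K\<^sub>1 L\<close>, because \<open>[J, _]\<close> is a derivation with \<open>[J, L] = L + 1\<close>;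
  the same holds one index higher. Substitution gives the identity. In the proof everything is
  written in terms of the \<open>X\<^sub>i\<close>, and moving \<open>J\<close> to the right past \<open>L\<close> normalizes both sides.
\<close>

lemma elimination_identity:
  fixes J L :: "complex^'n^'n" and c :: real
  assumes JL: "J ** L = L ** J + L + mat 1"
    and 1: "L ** X\<^sub>2 - X\<^sub>1 ** L = c *\<^sub>R mat 1 + \<Phi>\<^sub>1"
    and 2: "L ** X\<^sub>3 - X\<^sub>2 ** L = (c + 2) *\<^sub>R mat 1 + \<Phi>\<^sub>2"
    and K1: "K\<^sub>1 = X\<^sub>1 + commutator J X\<^sub>1"
    and K2: "K\<^sub>2 = X\<^sub>2 + commutator J X\<^sub>2"
    and K3: "K\<^sub>3 = X\<^sub>3 + commutator J X\<^sub>3"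
  shows "L ** (L ** K\<^sub>3) =
    (- commutator J \<Phi>\<^sub>1 - K\<^sub>1 ** L + L ** K\<^sub>2) ** L - 2 *\<^sub>R mat 1 - \<Phi>\<^sub>2 + \<Phi>\<^sub>1
      + L ** commutator J \<Phi>\<^sub>2 + L ** K\<^sub>2 ** L"
proof -
  have JL': "J ** (L ** Z) = L ** (J ** Z) + L ** Z + Z" for Z :: "complex^'n^'n"
    using arg_cong[OF JL, of "\<lambda>Y. Y ** Z"] by (simp add: matrix_ring_simps)
  have P1: "\<Phi>\<^sub>1 = L ** X\<^sub>2 - X\<^sub>1 ** L - c *\<^sub>R mat 1" using 1 by (simp add: algebra_simps)
  have P2: "\<Phi>\<^sub>2 = L ** X\<^sub>3 - X\<^sub>2 ** L - (c + 2) *\<^sub>R mat 1" using 2 by (simp add: algebra_simps)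
  show ?thesis
    unfolding P1 P2 K1 K2 K3 commutator_def
    by (simp add: matrix_ring_simps JL JL' algebra_simps)
qed

section \<open>Biorthogonal systems and Pearson relations\<close>

text \<open>
  Orthogonality of monic polynomials in terms of coefficients and moments: \<open>C n\<close> lists the
  coefficients of \<open>P\<^sub>n\<close> and \<open>D m\<close> those of the adjoint of \<open>P\<^sub>m\<close>. Keeping the two families separate makes the
  computations below purely algebraic.
\<close>

locale biorthogonal =
  fixes \<mu> :: "nat \<Rightarrow> complex^'n^'n" and C D :: "nat \<Rightarrow> nat \<Rightarrow> complex^'n^'n"
    and H :: "nat \<Rightarrow> complex^'n^'n"
  assumes monic: "C n n = mat 1" "D n n = mat 1"
    and orth: "(\<Sum>i\<le>n. \<Sum>j\<le>m. C n i ** \<mu> (i + j) ** D m j) = (if n = m then H n else 0)"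
begin

text \<open>
  With \<open>D m j\<close> the conjugate transpose of the coefficient of \<open>x\<^sup>j\<close> in \<open>P\<^sub>m\<close>, these are the pairings
  \<open>\<langle>x\<^sup>k, P\<^sub>m\<rangle>\<close> and \<open>\<langle>P\<^sub>n, x\<^sup>k\<rangle>\<close>.
\<close>

definition left_moment :: "nat \<Rightarrow> nat \<Rightarrow> complex^'n^'n" where
  "left_moment k m = (\<Sum>j\<le>m. \<mu> (k + j) ** D m j)"

definition right_moment :: "nat \<Rightarrow> nat \<Rightarrow> complex^'n^'n" where
  "right_moment n k = (\<Sum>i\<le>n. C n i ** \<mu> (i + k))"

lemma orth_left: "(\<Sum>i\<le>n. C n i ** left_moment i m) = (if n = m then H n else 0)"
  unfolding orth[symmetric] by (simp add: left_moment_def matmul.sum_right matrix_mul_assoc)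

lemma orth_right: "(\<Sum>j\<le>m. right_moment n j ** D m j) = (if n = m then H n else 0)"
  unfolding orth[symmetric] by (simp add: right_moment_def matmul.sum_left) (rule sum.swap)

text \<open>
  As \<open>P\<^sub>k\<close> is monic, \<open>x\<^sup>k\<close> differs from it by lower powers, which are orthogonal to \<open>P\<^sub>m\<close> by induction.
\<close>

lemma left_moment_less: "k < m \<Longrightarrow> left_moment k m = 0"
proof (induction k rule: less_induct)
  case (less k)
  have "(\<Sum>i\<le>k. C k i ** left_moment i m) = left_moment k m"
    using less by (simp add: monic lessThan_Suc_atMost[symmetric])
  then show ?case using less.prems orth_left[of k m] by simp
qed

lemma left_moment_eq: "left_moment m m = H m"
  using orth_left[of m m] by (simp add: lessThan_Suc_atMost[symmetric] left_moment_less monic)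

lemma left_moment_Suc: "left_moment (Suc m) m = - (C (Suc m) m ** H m)"
proof -
  have "C (Suc m) m ** H m + left_moment (Suc m) m = 0"
    using orth_left[of "Suc m" m] by (simp add: lessThan_Suc_atMost[symmetric] left_moment_less left_moment_eq monic)
  then show ?thesis by (metis eq_neg_iff_add_eq_0 add.commute)
qed

lemma right_moment_less: "k < n \<Longrightarrow> right_moment n k = 0"
proof (induction k rule: less_induct)
  case (less k)
  have "(\<Sum>j\<le>k. right_moment n j ** D k j) = right_moment n k"
    using less by (simp add: monic lessThan_Suc_atMost[symmetric])
  then show ?case using less.prems orth_right[of n k] by simp
qed

lemma right_moment_eq: "right_moment n n = H n"
  using orth_right[of n n] by (simp add: lessThan_Suc_atMost[symmetric] right_moment_less monic)

end

locale pearson = biorthogonal \<mu> C D H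
  for \<mu> :: "nat \<Rightarrow> complex^'n^'n" and C D H +
  fixes J L M :: "complex^'n^'n" and \<nu> :: real
  assumes pearson_left: "(real m + 1 + \<nu>) *\<^sub>R \<mu> m + \<mu> m ** J = - (L ** \<mu> (Suc m))"
    and pearson_right: "(real m + 1 + \<nu>) *\<^sub>R \<mu> m + J ** \<mu> m = - (\<mu> (Suc m) ** M)"
begin

text \<open>
  The left Pearson relation paired with \<open>P\<^sub>n\<close> on both sides, for \<open>n = p + 1\<close>. Its term with \<open>real m\<close>,
  where \<open>m = i + j\<close>, splits into the Euler operator \<open>x d/dx\<close> acting on either factor, and each half
  contributes \<open>n H\<^sub>n\<close>. On the right-hand side only the two highest powers of \<open>x P\<^sub>n\<close> survive.
\<close>

lemma subleading_left:
  "L ** C (Suc (Suc p)) (Suc p) ** H (Suc p) - C (Suc p) p ** L ** H (Suc p) =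
    (2 * real (Suc p) + 1 + \<nu>) *\<^sub>R H (Suc p) + H (Suc p) ** J"
proof -
  let ?n = "Suc p"
  let ?S = "\<lambda>f. \<Sum>i\<le>?n. \<Sum>j\<le>?n. C ?n i ** f i j ** D ?n j"
  have sums: "?S (\<lambda>i j. (real (i + j) + 1 + \<nu>) *\<^sub>R \<mu> (i + j) + \<mu> (i + j) ** J) =
      ?S (\<lambda>i j. - (L ** \<mu> (Suc (i + j))))"
    by (simp only: pearson_left)
  have lhs: "?S (\<lambda>i j. (real (i + j) + 1 + \<nu>) *\<^sub>R \<mu> (i + j) + \<mu> (i + j) ** J) =
      (\<Sum>i\<le>?n. real i *\<^sub>R (C ?n i ** left_moment i ?n)) + (\<Sum>j\<le>?n. real j *\<^sub>R (right_moment ?n j ** D ?n j))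
      + (1 + \<nu>) *\<^sub>R (\<Sum>i\<le>?n. C ?n i ** left_moment i ?n) + (\<Sum>j\<le>?n. right_moment ?n j ** J ** D ?n j)"
  proof -
    have "(\<Sum>j\<le>?n. real j *\<^sub>R (right_moment ?n j ** D ?n j)) =
        ?S (\<lambda>i j. real j *\<^sub>R \<mu> (i + j))"
      "(\<Sum>j\<le>?n. right_moment ?n j ** J ** D ?n j) = ?S (\<lambda>i j. \<mu> (i + j) ** J)"
      by (subst sum.swap, simp add: right_moment_def matmul.sum_left matrix_ring_simps scaleR_sum_right
          del: sum.atMost_Suc)+
    then show ?thesis
      by (simp add: left_moment_def matmul.sum_right matrix_ring_simps scaleR_sum_right scaleR_add_left
          sum.distrib del: sum.atMost_Suc)
  qed
  have rhs: "?S (\<lambda>i j. - (L ** \<mu> (Suc (i + j)))) = - (\<Sum>i\<le>?n. C ?n i ** L ** left_moment (Suc i) ?n)"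
    by (simp add: left_moment_def matmul.sum_right matrix_ring_simps sum_negf del: sum.atMost_Suc)
  have vals: "(\<Sum>i\<le>?n. real i *\<^sub>R (C ?n i ** left_moment i ?n)) = real ?n *\<^sub>R H ?n"
    "(\<Sum>j\<le>?n. real j *\<^sub>R (right_moment ?n j ** D ?n j)) = real ?n *\<^sub>R H ?n"
    "(\<Sum>j\<le>?n. right_moment ?n j ** J ** D ?n j) = H ?n ** J"
    "(\<Sum>i\<le>?n. C ?n i ** L ** left_moment (Suc i) ?n) =
       C ?n p ** L ** H ?n - L ** C (Suc ?n) ?n ** H ?n"
    by (simp_all add: lessThan_Suc_atMost[symmetric] left_moment_less left_moment_eq left_moment_Suc
        right_moment_less right_moment_eq monic matrix_ring_simps)
  have "real ?n *\<^sub>R H ?n + real ?n *\<^sub>R H ?n + (1 + \<nu>) *\<^sub>R H ?n + H ?n ** J =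
      - (C ?n p ** L ** H ?n - L ** C (Suc ?n) ?n ** H ?n)"
    using sums unfolding lhs rhs vals orth_left by (simp only: refl if_True)
  moreover have "2 * real ?n + 1 + \<nu> = real ?n + real ?n + (1 + \<nu>)" by simp
  ultimately show ?thesis by (simp only: scaleR_add_left) simp
qed

text \<open>
  The right Pearson relation paired between \<open>P\<^sub>n\<close> and \<open>P\<^sub>p\<close>, for \<open>n = p + 1\<close>. In the two sums over the
  powers in \<open>P\<^sub>n\<close>, the powers \<open>x\<^sup>n\<close> and \<open>x\<^sup>p\<close> contribute multiples of \<open>X\<^sub>n H\<^sub>p\<close>, weighted by \<open>n\<close> and \<open>p\<close> in one
  and by \<open>J\<close> in the other; the differences are \<open>- X\<^sub>n H\<^sub>p\<close> and \<open>- [J, X\<^sub>n] H\<^sub>p\<close>.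
\<close>

lemma subleading_right:
  "C (Suc p) p ** H p + commutator J (C (Suc p) p) ** H p = H (Suc p) ** M"
proof -
  let ?n = "Suc p"
  let ?S = "\<lambda>f. \<Sum>i\<le>?n. \<Sum>j\<le>p. C ?n i ** f i j ** D p j"
  have sums: "?S (\<lambda>i j. (real (i + j) + 1 + \<nu>) *\<^sub>R \<mu> (i + j) + J ** \<mu> (i + j)) =
      ?S (\<lambda>i j. - (\<mu> (Suc (i + j)) ** M))"
    by (simp only: pearson_right)
  have lhs: "?S (\<lambda>i j. (real (i + j) + 1 + \<nu>) *\<^sub>R \<mu> (i + j) + J ** \<mu> (i + j)) =
      (\<Sum>i\<le>?n. real i *\<^sub>R (C ?n i ** left_moment i p)) + (\<Sum>j\<le>p. real j *\<^sub>R (right_moment ?n j ** D p j))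
      + (1 + \<nu>) *\<^sub>R (\<Sum>i\<le>?n. C ?n i ** left_moment i p) + (\<Sum>i\<le>?n. C ?n i ** J ** left_moment i p)"
  proof -
    have "(\<Sum>j\<le>p. real j *\<^sub>R (right_moment ?n j ** D p j)) =
        ?S (\<lambda>i j. real j *\<^sub>R \<mu> (i + j))"
      by (subst sum.swap, simp add: right_moment_def matmul.sum_left matrix_ring_simps scaleR_sum_right
          del: sum.atMost_Suc)
    then show ?thesis
      by (simp add: left_moment_def matmul.sum_right matrix_ring_simps scaleR_sum_right scaleR_add_left
          sum.distrib del: sum.atMost_Suc)
  qed
  have rhs: "?S (\<lambda>i j. - (\<mu> (Suc (i + j)) ** M)) = - (\<Sum>j\<le>p. right_moment ?n (Suc j) ** M ** D p j)"
    by (subst sum.swap, simp add: right_moment_def matmul.sum_left matrix_ring_simps sum_negf del: sum.atMost_Suc)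
  have vals: "(\<Sum>i\<le>?n. real i *\<^sub>R (C ?n i ** left_moment i p)) = - (C ?n p ** H p)"
    "(\<Sum>j\<le>p. real j *\<^sub>R (right_moment ?n j ** D p j)) = 0"
    "(\<Sum>i\<le>?n. C ?n i ** J ** left_moment i p) = - (commutator J (C ?n p) ** H p)"
    "(\<Sum>j\<le>p. right_moment ?n (Suc j) ** M ** D p j) = H ?n ** M"
    by (simp_all add: lessThan_Suc_atMost[symmetric] left_moment_less left_moment_eq left_moment_Suc
        right_moment_less right_moment_eq monic
        matrix_ring_simps commutator_def algebra_simps scaleR_add_left)
  have "- (C ?n p ** H p) + 0 + (1 + \<nu>) *\<^sub>R 0 + - (commutator J (C ?n p) ** H p) =
      - (H ?n ** M)"
    using sums unfolding lhs rhs vals orth_left by (simp only: n_not_Suc_n Suc_n_not_n if_False)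
  then have "- (C ?n p ** H p + commutator J (C ?n p) ** H p) = - (H ?n ** M)" by simp
  then show ?thesis by (simp only: neg_equal_iff_equal)
qed

end

section \<open>Entries of the exponential and of the weight\<close>

locale enumerated =
  fixes N :: nat and e :: "nat \<Rightarrow> 'n::finite"
  assumes bij_e: "bij_betw e {1..N} UNIV"
begin

lemma e_eq_iff: "\<lbrakk>i \<in> {1..N}; j \<in> {1..N}\<rbrakk> \<Longrightarrow> e i = e j \<longleftrightarrow> i = j"
  by (rule inj_on_eq_iff[OF bij_betw_imp_inj_on[OF bij_e]])

lemma e_cases: obtains i where "i \<in> {1..N}" "p = e i"
proof -
  have "p \<in> e ` {1..N}" using bij_e by (simp add: bij_betw_def)
  then show thesis using that by blast
qed

lemma sum_UNIV_e: "(\<Sum>p\<in>UNIV. f p) = (\<Sum>i=1..N. f (e i))"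
  by (rule sum.reindex_bij_betw[OF bij_e, symmetric])

lemma matrix_eq_e:
  assumes "\<And>i j. \<lbrakk>i \<in> {1..N}; j \<in> {1..N}\<rbrakk> \<Longrightarrow> X $ e i $ e j = Y $ e i $ e j"
  shows "X = Y"
proof -
  have "X $ p $ q = Y $ p $ q" for p q
    by (rule e_cases[of p], rule e_cases[of q]) (simp add: assms)
  then show ?thesis by (simp add: vec_eq_iff)
qed

lemma mult_entry_e: "(X ** Y) $ p $ q = (\<Sum>k=1..N. X $ p $ e k * Y $ e k $ q)"
  by (simp add: matrix_matrix_mult_def sum_UNIV_e)

lemma matrix_unit_entry:
  assumes "i \<in> {1..N}" "j \<in> {1..N}" "p \<in> {1..N}" "q \<in> {1..N}"
  shows "matrix_unit e p q $ e i $ e j = (if p = i \<and> q = j then 1 else 0)"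
  using assms by (auto simp: matrix_unit_def e_eq_iff)

definition diagonal :: "(nat \<Rightarrow> real) \<Rightarrow> complex^'n^'n" where
  "diagonal d = (\<Sum>k=1..N. d k *\<^sub>R matrix_unit e k k)"

lemma J_matrix_altdef: "J_matrix N e = diagonal real"
  by (simp add: J_matrix_def diagonal_def)

lemma diagonal_entry:
  assumes "i \<in> {1..N}" "j \<in> {1..N}"
  shows "diagonal d $ e i $ e j = (if i = j then of_real (d i) else 0)"
proof -
  have "diagonal d $ e i $ e j =
      (\<Sum>k=1..N. if k = i then (if i = j then of_real (d i) else 0) else 0)"
    unfolding diagonal_def sum_component
    by (rule sum.cong) (use assms in \<open>auto simp: matrix_unit_entry of_real_def\<close>)
  also have "\<dots> = (if i = j then of_real (d i) else 0)"
    using assms by simp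
  finally show ?thesis .
qed

lemma A_matrix_entry:
  assumes "i \<in> {1..N}" "j \<in> {1..N}"
  shows "A_matrix N e a $ e i $ e j = (if i = Suc j then of_real (a j) else 0)"
proof -
  have "A_matrix N e a $ e i $ e j =
      (\<Sum>k\<in>{1..<N}. if k = j then (if i = Suc j then of_real (a j) else 0) else 0)"
    unfolding A_matrix_def sum_component
    by (rule sum.cong) (use assms in \<open>auto simp: matrix_unit_entry of_real_def\<close>)
  also have "\<dots> = (if i = Suc j then of_real (a j) else 0)"
    using assms by auto
  finally show ?thesis .
qed

lemma A_mult_entry:
  assumes "i \<in> {1..N}"
  shows "(A_matrix N e a ** X) $ e i $ q = (if 2 \<le> i then of_real (a (i - 1)) * X $ e (i - 1) $ q else 0)"
proof -
  have "(A_matrix N e a ** X) $ e i $ q =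
      (\<Sum>k=1..N. if k = i - 1 then of_real (a (i - 1)) * X $ e (i - 1) $ q else 0)"
    unfolding mult_entry_e by (rule sum.cong) (use assms in \<open>auto simp: A_matrix_entry\<close>)
  also have "\<dots> = (if 2 \<le> i then of_real (a (i - 1)) * X $ e (i - 1) $ q else 0)"
    using assms by auto
  finally show ?thesis .
qed

lemma mult_diagonal_entry:
  assumes "j \<in> {1..N}"
  shows "(X ** diagonal d) $ p $ e j = X $ p $ e j * of_real (d j)"
proof -
  have "(X ** diagonal d) $ p $ e j =
      (\<Sum>k=1..N. if k = j then X $ p $ e j * of_real (d j) else 0)"
    unfolding mult_entry_e by (rule sum.cong) (use assms in \<open>auto simp: diagonal_entry\<close>)
  also have "\<dots> = X $ p $ e j * of_real (d j)"
    using assms by auto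
  finally show ?thesis .
qed

lemma transpose_diagonal:
  "transpose (diagonal d) = diagonal d"
  by (rule matrix_eq_e) (simp add: transpose_def diagonal_entry)

text \<open>
  \<open>A\<close> is a weighted shift, so its \<open>k\<close>-th power lives on the \<open>k\<close>-th subdiagonal.
\<close>

lemma power_A_entry:
  assumes "i \<in> {1..N}" "j \<in> {1..N}"
  shows "matrix_power (x *\<^sub>R A_matrix N e a) k $ e i $ e j =
    (if i = j + k then of_real (x ^ k * (\<Prod>r\<in>{j..<i}. a r)) else 0)"
  using assms(1)
proof (induction k arbitrary: i)
  case 0
  then show ?case using assms(2) by (simp add: mat_def e_eq_iff)
next
  case (Suc k)
  have step: "matrix_power (x *\<^sub>R A_matrix N e a) (Suc k) $ e i $ e j =
      (if 2 \<le> i then of_real (x * a (i - 1)) * matrix_power (x *\<^sub>R A_matrix N e a) k $ e (i - 1) $ e j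
       else 0)"
    using Suc.prems by (simp add: matmul.scaleR_left A_mult_entry scaleR_conv_of_real[symmetric])
  show ?case
  proof (cases "i = j + Suc k")
    case True
    then have "{j..<i} = insert (i - 1) {j..<i - 1}" by auto
    then show ?thesis
      unfolding step using True Suc.prems assms(2) by (simp add: Suc.IH)
  next
    case False
    have "matrix_power (x *\<^sub>R A_matrix N e a) k $ e (i - 1) $ e j = 0" if "2 \<le> i"
    proof -
      have "i - 1 \<in> {1..N}" "i - 1 \<noteq> j + k" using that Suc.prems False by auto
      then show ?thesis by (simp only: Suc.IH if_False)
    qed
    with False show ?thesis unfolding step by (simp only: mult_zero_right if_cancel if_False) auto
  qed
qed

lemma power_A_eq_0: "N \<le> k \<Longrightarrow> matrix_power (x *\<^sub>R A_matrix N e a) k = 0"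
  by (rule matrix_eq_e) (auto simp: power_A_entry)

lemma exp_ctranspose_A:
  "matrix_exp (x *\<^sub>R ctranspose (A_matrix N e a)) = ctranspose (matrix_exp (x *\<^sub>R A_matrix N e a))"
proof -
  have *: "x *\<^sub>R ctranspose (A_matrix N e a) = ctranspose (x *\<^sub>R A_matrix N e a)"
    by (simp add: linear_cmul[OF linear_ctranspose])
  have zero: "matrix_power (ctranspose (x *\<^sub>R A_matrix N e a)) k = 0" if "N \<le> k" for k
    using that by (simp add: matrix_power_ctranspose power_A_eq_0 linear_0[OF linear_ctranspose])
  have "matrix_exp (ctranspose (x *\<^sub>R A_matrix N e a)) =
      (\<Sum>k<N. (1 / fact k) *\<^sub>R ctranspose (matrix_power (x *\<^sub>R A_matrix N e a) k))"
    unfolding matrix_power_ctranspose[symmetric] by (rule matrix_exp_nilpotent) (rule zero)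
  moreover have "matrix_exp (x *\<^sub>R A_matrix N e a) =
      (\<Sum>k<N. (1 / fact k) *\<^sub>R matrix_power (x *\<^sub>R A_matrix N e a) k)"
    by (rule matrix_exp_nilpotent) (rule power_A_eq_0)
  ultimately show ?thesis
    unfolding *
    by (simp only: linear_sum[OF linear_ctranspose] linear_cmul[OF linear_ctranspose])
qed

text \<open>
  The entry \<open>(i, j)\<close> of \<open>exp (x A)\<close> is \<open>exp_coeff a i j\<close> times \<open>x\<^sup>i\<^sup>-\<^sup>j\<close> when \<open>j \<le> i\<close>. For \<open>i < j\<close>
  the truncated difference makes the value \<open>1\<close>, so the case \<open>j \<le> i\<close> has to be kept explicit.
\<close>

definition exp_coeff :: "(nat \<Rightarrow> real) \<Rightarrow> nat \<Rightarrow> nat \<Rightarrow> real" where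
  "exp_coeff a i j = (\<Prod>r\<in>{j..<i}. a r) / fact (i - j)"

lemma exp_A_entry:
  assumes "i \<in> {1..N}" "j \<in> {1..N}"
  shows "matrix_exp (x *\<^sub>R A_matrix N e a) $ e i $ e j =
    (if j \<le> i then of_real (x ^ (i - j) * exp_coeff a i j) else 0)"
proof -
  have "matrix_exp (x *\<^sub>R A_matrix N e a) $ e i $ e j =
      (\<Sum>k<N. (1 / fact k) *\<^sub>R matrix_power (x *\<^sub>R A_matrix N e a) k $ e i $ e j)"
    by (simp add: matrix_exp_nilpotent[of N] power_A_eq_0)
  also have "\<dots> = (\<Sum>k<N. if k = i - j then
      (if j \<le> i then of_real (x ^ (i - j) * exp_coeff a i j) else 0) else 0)"
    using assms by (intro sum.cong) (auto simp: power_A_entry exp_coeff_def scaleR_conv_of_real[where 'a = complex])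
  also have "\<dots> = (if j \<le> i then of_real (x ^ (i - j) * exp_coeff a i j) else 0)"
    using assms by auto
  finally show ?thesis .
qed

lemma A_minus_1_kernel:
  assumes "(A_matrix N e a - mat 1) *v v = 0"
  shows "v = 0"
proof -
  have fix_v: "v = A_matrix N e a *v v"
    using assms by (simp add: matrix_vector_mult_diff_rdistrib)
  have step: "v $ e i = (if 2 \<le> i then of_real (a (i - 1)) * v $ e (i - 1) else 0)" if "i \<in> {1..N}" for i
  proof -
    have "v $ e i = (\<Sum>k=1..N. A_matrix N e a $ e i $ e k * v $ e k)"
      by (subst fix_v) (simp add: matrix_vector_mult_def sum_UNIV_e)
    also have "\<dots> = (\<Sum>k=1..N. if k = i - 1 then of_real (a (i - 1)) * v $ e (i - 1) else 0)"
      by (rule sum.cong) (use that in \<open>auto simp: A_matrix_entry\<close>)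
    finally show ?thesis using that by auto
  qed
  have "i \<in> {1..N} \<Longrightarrow> v $ e i = 0" for i
    by (induction i rule: less_induct) (subst step, auto)
  then have "v $ p = 0" for p
    by (metis e_cases)
  then show ?thesis by (simp add: vec_eq_iff)
qed

lemma invertible_A_minus_1: "invertible (A_matrix N e a - mat 1)"
  unfolding invertible_left_inverse matrix_left_invertible_ker using A_minus_1_kernel by blast

lemma commutator_J_A: "commutator (J_matrix N e) (A_matrix N e a) = A_matrix N e a"
proof (rule matrix_eq_e)
  fix i j assume ij: "i \<in> {1..N}" "j \<in> {1..N}"
  have "J_matrix N e ** A_matrix N e a =
      transpose (transpose (A_matrix N e a) ** J_matrix N e)"
    by (simp add: matrix_transpose_mul J_matrix_altdef transpose_diagonal)
  then have "(J_matrix N e ** A_matrix N e a) $ e i $ e j = of_nat i * A_matrix N e a $ e i $ e j"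
    using ij by (simp add: transpose_def J_matrix_altdef mult_diagonal_entry)
  then show "commutator (J_matrix N e) (A_matrix N e a) $ e i $ e j = A_matrix N e a $ e i $ e j"
    using ij by (simp add: commutator_def J_matrix_altdef mult_diagonal_entry A_matrix_entry algebra_simps)
qed

definition weight_entry :: "real \<Rightarrow> (nat \<Rightarrow> real) \<Rightarrow> (nat \<Rightarrow> real) \<Rightarrow> real \<Rightarrow> nat \<Rightarrow> nat \<Rightarrow> real" where
  "weight_entry \<nu> a \<delta> x i j = (\<Sum>r=1..min i j. \<delta> r * exp_coeff a i r * exp_coeff a j r *
     (x ^ (i - r) * x ^ (j - r) * x powr (\<nu> + real r) * exp (- x)))"

lemma W_weight_altdef:
  "W_weight N e a \<nu> \<delta> x = matrix_exp (x *\<^sub>R A_matrix N e a) ** T_weight N e \<nu> \<delta> x **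
     ctranspose (matrix_exp (x *\<^sub>R A_matrix N e a))"
  by (simp add: W_weight_def exp_ctranspose_A)

lemma T_weight_altdef:
  "T_weight N e \<nu> \<delta> x = diagonal (\<lambda>k. exp (- x) * (\<delta> k * x powr (\<nu> + real k)))"
  by (simp add: T_weight_def diagonal_def scaleR_sum_right)

lemma W_weight_entry:
  assumes "i \<in> {1..N}" "j \<in> {1..N}"
  shows "W_weight N e a \<nu> \<delta> x $ e i $ e j = of_real (weight_entry \<nu> a \<delta> x i j)"
proof -
  have "W_weight N e a \<nu> \<delta> x $ e i $ e j =
    (\<Sum>r=1..N. (matrix_exp (x *\<^sub>R A_matrix N e a) $ e i $ e r *
         of_real (exp (- x) * (\<delta> r * x powr (\<nu> + real r)))) *
       cnj (matrix_exp (x *\<^sub>R A_matrix N e a) $ e j $ e r))"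
    unfolding W_weight_altdef T_weight_altdef
    by (subst mult_entry_e, intro sum.cong refl)
      (simp only: mult_diagonal_entry ctranspose_def vec_lambda_beta)
  also have "\<dots> = (\<Sum>r=1..N. if r \<le> min i j then of_real (\<delta> r * exp_coeff a i r * exp_coeff a j r *
     (x ^ (i - r) * x ^ (j - r) * x powr (\<nu> + real r) * exp (- x))) else 0)"
    using assms by (intro sum.cong) (auto simp: exp_A_entry)
  also have "\<dots> = (\<Sum>r=1..min i j. of_real (\<delta> r * exp_coeff a i r * exp_coeff a j r *
     (x ^ (i - r) * x ^ (j - r) * x powr (\<nu> + real r) * exp (- x))))"
    using assms by (intro sum.mono_neutral_cong_right) auto
  finally show ?thesis by (simp add: weight_entry_def)
qed

end

section \<open>Moments\<close>

lemma has_bochner_integral_Gamma: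
  fixes s :: real
  assumes "s > 0"
  shows "has_bochner_integral lborel (\<lambda>x. indicator {0..} x * (x powr (s - 1) / exp x)) (Gamma s)"
proof (rule has_bochner_integral_nn_integral)
  show "(\<integral>\<^sup>+ x. ennreal (indicator {0..} x * (x powr (s - 1) / exp x)) \<partial>lborel) = ennreal (Gamma s)"
    using Gamma_conv_nn_integral_real[OF assms] by simp
  show "0 \<le> Gamma s" using Gamma_real_pos[OF assms] by simp
qed auto

context enumerated
begin

text \<open>
  Termwise integration of \<open>x\<^sup>m\<close> times the entry \<open>(i, j)\<close> of the weight: the term with index \<open>r\<close> has the power
  \<open>x powr (m + (i - r) + (j - r) + \<nu> + r)\<close>.
\<close>

definition moment_entry :: "real \<Rightarrow> (nat \<Rightarrow> real) \<Rightarrow> (nat \<Rightarrow> real) \<Rightarrow> nat \<Rightarrow> nat \<Rightarrow> nat \<Rightarrow> real" where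
  "moment_entry \<nu> a \<delta> m i j = (\<Sum>r=1..min i j. \<delta> r * exp_coeff a i r * exp_coeff a j r *
     Gamma (\<nu> + real (i + j - r + m + 1)))"

definition moment :: "real \<Rightarrow> (nat \<Rightarrow> real) \<Rightarrow> (nat \<Rightarrow> real) \<Rightarrow> nat \<Rightarrow> complex^'n^'n" where
  "moment \<nu> a \<delta> m = (\<Sum>i=1..N. \<Sum>j=1..N. moment_entry \<nu> a \<delta> m i j *\<^sub>R matrix_unit e i j)"

lemma unit_expansion_entry:
  assumes "i \<in> {1..N}" "j \<in> {1..N}"
  shows "(\<Sum>p=1..N. \<Sum>q=1..N. c p q *\<^sub>R matrix_unit e p q) $ e i $ e j = of_real (c i j)"
proof -
  have "(\<Sum>p=1..N. \<Sum>q=1..N. c p q *\<^sub>R matrix_unit e p q) $ e i $ e j =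
      (\<Sum>p=1..N. \<Sum>q=1..N. if q = j then if p = i then of_real (c i j) else 0 else 0)"
    unfolding sum_component
    by (intro sum.cong) (use assms in \<open>auto simp: matrix_unit_entry of_real_def\<close>)
  also have "\<dots> = of_real (c i j)"
    using assms by simp
  finally show ?thesis .
qed

lemma moment_nth:
  "\<lbrakk>i \<in> {1..N}; j \<in> {1..N}\<rbrakk> \<Longrightarrow> moment \<nu> a \<delta> m $ e i $ e j = of_real (moment_entry \<nu> a \<delta> m i j)"
  unfolding moment_def by (rule unit_expansion_entry)

lemma weight_entry_moment:
  assumes "\<nu> > 0"
  shows "has_bochner_integral lborel (\<lambda>x. indicator {0..} x * (x ^ m * weight_entry \<nu> a \<delta> x i j))
    (moment_entry \<nu> a \<delta> m i j)"
proof -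
  have eq: "indicator {0..} x * (x ^ m * (x ^ (i - r) * x ^ (j - r) * x powr (\<nu> + real r) * exp (- x))) =
      indicator {0..} x * (x powr (\<nu> + real (i + j - r + m + 1) - 1) / exp x)"
    if "r \<in> {1..min i j}" for r and x :: real
  proof (cases "0 < x")
    case True
    then have "x ^ m * x ^ (i - r) * x ^ (j - r) * x powr (\<nu> + real r) =
        x powr (real m + real (i - r) + real (j - r) + (\<nu> + real r))"
      by (simp only: powr_add powr_realpow)
    also have "real m + real (i - r) + real (j - r) + (\<nu> + real r) = \<nu> + real (i + j - r + m + 1) - 1"
      using that by (simp add: of_nat_diff)
    finally show ?thesis by (simp add: exp_minus field_simps)
  qed (auto simp: indicator_def order_antisym_conv)
  have "has_bochner_integral lborel
     (\<lambda>x. \<Sum>r=1..min i j. \<delta> r * exp_coeff a i r * exp_coeff a j r *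
        (indicator {0..} x * (x powr (\<nu> + real (i + j - r + m + 1) - 1) / exp x)))
     (moment_entry \<nu> a \<delta> m i j)"
    unfolding moment_entry_def
    by (intro has_bochner_integral_sum has_bochner_integral_mult_right has_bochner_integral_Gamma)
      (use assms in simp)
  also have "(\<lambda>x. \<Sum>r=1..min i j. \<delta> r * exp_coeff a i r * exp_coeff a j r *
        (indicator {0..} x * (x powr (\<nu> + real (i + j - r + m + 1) - 1) / exp x))) =
      (\<lambda>x. indicator {0..} x * (x ^ m * weight_entry \<nu> a \<delta> x i j))"
    unfolding weight_entry_def sum_distrib_left
    by (intro ext sum.cong refl, subst eq[symmetric]) (simp_all add: mult_ac)
  finally show ?thesis .
qed

lemma has_bochner_integral_moment:
  assumes "\<nu> > 0"
  shows "has_bochner_integral lborel (\<lambda>x. indicator {0..} x *\<^sub>R (x ^ m *\<^sub>R W_weight N e a \<nu> \<delta> x))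
    (moment \<nu> a \<delta> m)"
proof -
  have W: "W_weight N e a \<nu> \<delta> x = (\<Sum>i=1..N. \<Sum>j=1..N. weight_entry \<nu> a \<delta> x i j *\<^sub>R matrix_unit e i j)"
    for x
    by (rule matrix_eq_e) (simp only: W_weight_entry unit_expansion_entry)
  show ?thesis
    unfolding W moment_def scaleR_sum_right scaleR_scaleR
    by (intro has_bochner_integral_sum has_bochner_integral_scaleR_left weight_entry_moment assms)
qed

text \<open>
  Entrywise this is \<open>Gamma (z + 1) = z * Gamma z\<close> with \<open>z = \<nu> + i + j - r + m + 1\<close>. The factor \<open>z\<close> splits as
  \<open>(m + 1 + \<nu> + j) + (i - r)\<close>. The first part gives the left-hand side, \<open>j\<close> being the action of \<open>J\<close> from the
  right. The second part is the contribution of \<open>A\<close>, since \<open>a\<^sub>i\<^sub>-\<^sub>1\<close> times the exponential coefficient at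
  \<open>(i - 1, r)\<close> equals \<open>i - r\<close> times the one at \<open>(i, r)\<close>.
\<close>

lemma moment_pearson_left:
  assumes "\<nu> > 0"
  shows "(real m + 1 + \<nu>) *\<^sub>R moment \<nu> a \<delta> m + moment \<nu> a \<delta> m ** J_matrix N e =
    - ((A_matrix N e a - mat 1) ** moment \<nu> a \<delta> (Suc m))"
proof (rule matrix_eq_e)
  fix i j assume ij: "i \<in> {1..N}" "j \<in> {1..N}"
  let ?c = "\<lambda>r. \<delta> r * exp_coeff a i r * exp_coeff a j r * Gamma (\<nu> + real (i + j - r + m + 1))"
  have shifted: "a (i - 1) * moment_entry \<nu> a \<delta> (Suc m) (i - 1) j =
      (\<Sum>r=1..min i j. real (i - r) * ?c r)" if "2 \<le> i"
  proof -
    have "a (i - 1) * moment_entry \<nu> a \<delta> (Suc m) (i - 1) j =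
        (\<Sum>r=1..min (i - 1) j. real (i - r) * ?c r)"
      unfolding moment_entry_def sum_distrib_left
    proof (intro sum.cong refl)
      fix r assume r: "r \<in> {1..min (i - 1) j}"
      then have "{r..<i} = insert (i - 1) {r..<i - 1}" "i - r = Suc (i - 1 - r)" by auto
      then have coeff: "a (i - 1) * exp_coeff a (i - 1) r = real (i - r) * exp_coeff a i r"
        by (simp add: exp_coeff_def divide_simps)
      have index: "i - 1 + j - r + Suc m + 1 = i + j - r + m + 1" using r by auto
      let ?g = "Gamma (\<nu> + real (i + j - r + m + 1))"
      have "a (i - 1) * (\<delta> r * exp_coeff a (i - 1) r * exp_coeff a j r * ?g) =
          (a (i - 1) * exp_coeff a (i - 1) r) * (\<delta> r * exp_coeff a j r * ?g)"
        by (simp only: mult_ac)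
      also have "\<dots> = real (i - r) * ?c r"
        unfolding coeff by (simp only: mult_ac)
      finally show "a (i - 1) * (\<delta> r * exp_coeff a (i - 1) r * exp_coeff a j r *
          Gamma (\<nu> + real (i - 1 + j - r + Suc m + 1))) = real (i - r) * ?c r"
        unfolding index .
    qed
    \<comment> \<open>If the upper bound grows, the additional index is \<open>r = i\<close>, where the factor \<open>i - r\<close> vanishes.\<close>
    also have "\<dots> = (\<Sum>r=1..min i j. real (i - r) * ?c r)"
      by (rule sum.mono_neutral_left) (auto simp: min_def split: if_splits)
    finally show ?thesis .
  qed
  have "moment_entry \<nu> a \<delta> (Suc m) i j = (\<Sum>r=1..min i j. (\<nu> + real (i + j - r + m + 1)) * ?c r)"
    unfolding moment_entry_def
  proof (intro sum.cong refl)
    fix r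
    have "Gamma (\<nu> + real (i + j - r + m + 1) + 1) =
        (\<nu> + real (i + j - r + m + 1)) * Gamma (\<nu> + real (i + j - r + m + 1))"
      by (rule Gamma_plus1) (use assms in \<open>auto simp: nonpos_Ints_def\<close>)
    then show "\<delta> r * exp_coeff a i r * exp_coeff a j r * Gamma (\<nu> + real (i + j - r + Suc m + 1)) =
        (\<nu> + real (i + j - r + m + 1)) * ?c r"
      by (simp add: algebra_simps)
  qed
  also have "\<dots> = (\<Sum>r=1..min i j. (real m + 1 + \<nu> + real j) * ?c r + real (i - r) * ?c r)"
  proof (intro sum.cong refl)
    fix r assume "r \<in> {1..min i j}"
    then have "\<nu> + real (i + j - r + m + 1) = (real m + 1 + \<nu> + real j) + real (i - r)"
      by (simp add: of_nat_diff)
    then show "(\<nu> + real (i + j - r + m + 1)) * ?c r =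
        (real m + 1 + \<nu> + real j) * ?c r + real (i - r) * ?c r"
      by (simp only: distrib_right)
  qed
  also have "\<dots> = (real m + 1 + \<nu> + real j) * moment_entry \<nu> a \<delta> m i j +
      (\<Sum>r=1..min i j. real (i - r) * ?c r)"
    by (simp add: sum.distrib moment_entry_def sum_distrib_left)
  finally have up: "moment_entry \<nu> a \<delta> (Suc m) i j =
      (real m + 1 + \<nu> + real j) * moment_entry \<nu> a \<delta> m i j + (\<Sum>r=1..min i j. real (i - r) * ?c r)" .
  have first: "(\<Sum>r=1..min i j. real (i - r) * ?c r) = 0" if "\<not> 2 \<le> i"
    using that by (intro sum.neutral) auto
  have real_eq: "(real m + 1 + \<nu>) * moment_entry \<nu> a \<delta> m i j + moment_entry \<nu> a \<delta> m i j * real j =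
      moment_entry \<nu> a \<delta> (Suc m) i j -
        (if 2 \<le> i then a (i - 1) * moment_entry \<nu> a \<delta> (Suc m) (i - 1) j else 0)"
  proof (cases "2 \<le> i")
    case True
    show ?thesis
      unfolding up shifted[OF True]
      by (simp only: True if_True add_diff_cancel_right' distrib_right mult.commute[of _ "real j"])
  next
    case False
    show ?thesis
      unfolding up first[OF False]
      by (simp only: False if_False add_0_right diff_zero distrib_right mult.commute[of _ "real j"])
  qed
  have above: "moment \<nu> a \<delta> (Suc m) $ e (i - 1) $ e j = of_real (moment_entry \<nu> a \<delta> (Suc m) (i - 1) j)"
    if "2 \<le> i"
    by (rule moment_nth) (use ij that in auto)
  show "((real m + 1 + \<nu>) *\<^sub>R moment \<nu> a \<delta> m + moment \<nu> a \<delta> m ** J_matrix N e) $ e i $ e j =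
      (- ((A_matrix N e a - mat 1) ** moment \<nu> a \<delta> (Suc m))) $ e i $ e j"
    using arg_cong[OF real_eq, of complex_of_real] ij above
    by (auto simp: matmul.diff_left A_mult_entry J_matrix_altdef mult_diagonal_entry moment_nth
        scaleR_conv_of_real[where 'a = complex] split: if_splits)
qed

lemma transpose_moment: "transpose (moment \<nu> a \<delta> m) = moment \<nu> a \<delta> m"
  by (rule matrix_eq_e) (simp add: transpose_def moment_nth moment_entry_def min.commute mult_ac add.commute)

lemma moment_pearson_right:
  assumes "\<nu> > 0"
  shows "(real m + 1 + \<nu>) *\<^sub>R moment \<nu> a \<delta> m + J_matrix N e ** moment \<nu> a \<delta> m =
    - (moment \<nu> a \<delta> (Suc m) ** (transpose (A_matrix N e a) - mat 1))"
proof -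
  have lin: "transpose (X + Y) = transpose X + transpose Y" "transpose (c *\<^sub>R X) = c *\<^sub>R transpose X"
    "transpose (- X) = - transpose X" "transpose (X - Y) = transpose X - transpose Y"
    for X Y :: "complex^'n^'n" and c :: real
    by (simp_all add: transpose_def vec_eq_iff)
  show ?thesis
    using arg_cong[OF moment_pearson_left[OF assms, of m a \<delta>], of transpose]
    by (simp add: lin matrix_transpose_mul transpose_moment J_matrix_altdef transpose_diagonal transpose_mat)
qed

lemma moment_0_entry:
  assumes "i \<in> {1..N}" "j \<in> {1..N}" "\<nu> > 0"
  shows "moment \<nu> a \<delta> 0 $ e i $ e j = complex_of_real (Gamma \<nu> *
      (\<Sum>r=1..min i j. \<delta> r / (fact (i - r) * fact (j - r))
         * (\<Prod>k\<in>{r..<i}. a k) * (\<Prod>s\<in>{r..<j}. a s) * pochhammer \<nu> (i + j - r + 1)))"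
proof -
  have gamma: "Gamma (\<nu> + real (i + j - r + 0 + 1)) = Gamma \<nu> * pochhammer \<nu> (i + j - r + 1)" for r
  proof -
    have "\<nu> \<notin> \<int>\<^sub>\<le>\<^sub>0" using assms(3) by (auto simp: nonpos_Ints_def)
    from pochhammer_Gamma[OF this, of "i + j - r + 1"] show ?thesis
      using Gamma_real_pos[OF assms(3)] by (simp add: field_simps)
  qed
  show ?thesis
    unfolding moment_nth[OF assms(1,2)] moment_entry_def exp_coeff_def sum_distrib_left gamma
    by (simp only: times_divide_times_eq times_divide_eq_left times_divide_eq_right divide_divide_eq_left mult_ac)
qed

lemma has_bochner_integral_weighted:
  assumes "\<nu> > 0"
  shows "has_bochner_integral lborel
    (\<lambda>x. indicator {0..} x *\<^sub>R (matrix_poly p x ** W_weight N e a \<nu> \<delta> x ** ctranspose (matrix_poly q x)))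
    (\<Sum>i\<le>degree p. \<Sum>j\<le>degree q. coeff p i ** moment \<nu> a \<delta> (i + j) ** ctranspose (coeff q j))"
proof -
  have expand: "indicator {0..} x *\<^sub>R (matrix_poly p x ** W_weight N e a \<nu> \<delta> x ** ctranspose (matrix_poly q x)) =
     (\<Sum>i\<le>degree p. \<Sum>j\<le>degree q. coeff p i ** (indicator {0..} x *\<^sub>R (x ^ (i + j) *\<^sub>R W_weight N e a \<nu> \<delta> x))
        ** ctranspose (coeff q j))" for x :: real
    by (simp add: matrix_poly_def matmul.sum_left matmul.sum_right linear_sum[OF linear_ctranspose]
        linear_cmul[OF linear_ctranspose] matmul.scaleR_left matmul.scaleR_right scaleR_sum_right power_add mult_ac)
      (subst sum.swap, simp add: mult_ac)
  have sandwich: "bounded_linear (\<lambda>X. B ** X ** C)" for B C :: "complex^'n^'n"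
    by (rule bounded_linear_compose[OF matmul.bounded_linear_left matmul.bounded_linear_right])
  have monomial: "has_bochner_integral lborel
      (\<lambda>x. B ** (indicator {0..} x *\<^sub>R (x ^ m *\<^sub>R W_weight N e a \<nu> \<delta> x)) ** C) (B ** moment \<nu> a \<delta> m ** C)"
    for B C :: "complex^'n^'n" and m
    by (rule has_bochner_integral_bounded_linear[OF sandwich has_bochner_integral_moment[OF assms]])
  show ?thesis
    unfolding expand by (intro has_bochner_integral_sum monomial)
qed

end

section \<open>Positivity and invertibility of the norms\<close>

text \<open>
  The value \<open>w X w\<^sup>*\<close> of the sesquilinear form of \<open>X\<close> at the row vector \<open>w\<close>.
\<close>

definition quad_form :: "complex^'n^'n \<Rightarrow> complex^'n \<Rightarrow> complex" where
  "quad_form X w = (\<Sum>q\<in>UNIV. (w v* X) $ q * cnj (w $ q))"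

lemma quad_form_congruence: "quad_form (B ** X ** ctranspose B) w = quad_form X (w v* B)"
proof -
  define z where "z = (w v* B) v* X"
  have "quad_form (B ** X ** ctranspose B) w = (\<Sum>q\<in>UNIV. (z v* ctranspose B) $ q * cnj (w $ q))"
    by (simp add: quad_form_def z_def vector_matrix_mul_assoc)
  also have "\<dots> = (\<Sum>q\<in>UNIV. \<Sum>p\<in>UNIV. cnj (B $ q $ p) * z $ p * cnj (w $ q))"
    by (simp add: vector_matrix_mult_def ctranspose_def sum_distrib_right sum_distrib_left mult_ac)
  also have "\<dots> = (\<Sum>p\<in>UNIV. \<Sum>q\<in>UNIV. cnj (B $ q $ p) * z $ p * cnj (w $ q))"
    by (rule sum.swap)
  also have "\<dots> = (\<Sum>p\<in>UNIV. z $ p * cnj ((w v* B) $ p))"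
    by (simp add: vector_matrix_mult_def sum_distrib_right sum_distrib_left mult_ac)
  finally show ?thesis by (simp add: quad_form_def z_def)
qed

lemma bounded_linear_Re_quad_form: "bounded_linear (\<lambda>X. Re (quad_form X w))"
proof (subst linear_conv_bounded_linear[symmetric], rule linearI)
  show "Re (quad_form (X + Y) w) = Re (quad_form X w) + Re (quad_form Y w)" for X Y
    by (simp add: quad_form_def vector_matrix_mult_def algebra_simps sum.distrib)
  have "quad_form (c *\<^sub>R X) w = c *\<^sub>R quad_form X w" for c :: real and X
    by (simp add: quad_form_def vector_matrix_mult_def scaleR_sum_right sum_distrib_right)
  then show "Re (quad_form (c *\<^sub>R X) w) = c *\<^sub>R Re (quad_form X w)" for c X by simp
qed

lemma vector_matrix_poly_nth:
  "(w v* matrix_poly p x) $ q = (\<Sum>k\<le>degree p. (w v* coeff p k) $ q * of_real x ^ k)"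
  by (simp add: matrix_poly_def vector_matrix_mult_def sum_distrib_left sum_distrib_right
      scaleR_conv_of_real[where 'a = complex] mult_ac)
    (rule sum.swap)

text \<open>
  A component of the row \<open>w P(x)\<close> is a scalar polynomial in \<open>x\<close> whose coefficient of degree \<open>n\<close> is the
  component of \<open>w\<close>. If \<open>w\<close> were nonzero, one of them would have only finitely many roots, which cannot cover
  almost all of \<open>x > 0\<close>.
\<close>

lemma monic_row_eq_0:
  assumes "matrix_monic p n" and AE: "AE x in lborel. 0 < x \<longrightarrow> w v* matrix_poly p x = 0"
  shows "w = 0"
proof (rule ccontr)
  assume "w \<noteq> 0"
  then obtain q where q: "w $ q \<noteq> 0" by (auto simp: vec_eq_iff)
  define c where "c k = (w v* coeff p k) $ q" for k
  have "c n \<noteq> 0" "degree p = n"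
    using assms(1) q by (simp_all add: c_def matrix_monic_def)
  then have "finite {z. (\<Sum>k\<le>n. c k * z ^ k) = 0}"
    unfolding polyfun_finite_roots by auto
  then have "finite (complex_of_real -` {z. (\<Sum>k\<le>n. c k * z ^ k) = 0})"
    by (rule finite_vimageI) (simp add: inj_on_def)
  then have "complex_of_real -` {z. (\<Sum>k\<le>n. c k * z ^ k) = 0} \<in> null_sets lborel"
    by (rule finite_imp_null_set_lborel)
  from AE_not_in[OF this] AE have "AE x in lborel. \<not> (0::real) < x"
  proof eventually_elim
    case (elim x)
    then show ?case
      using vector_matrix_poly_nth[of w p x q] \<open>degree p = n\<close> by (auto simp: c_def)
  qed
  then have "AE x in lborel. x \<notin> {0<..<1::real}" by eventually_elim auto
  then have "{0<..<1::real} \<in> null_sets lborel"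
    by (subst (asm) AE_iff_null_sets[symmetric]) simp_all
  then show False by (simp add: null_sets_def)
qed

context enumerated
begin

lemma quad_form_diagonal:
  "quad_form (diagonal d) w = of_real (\<Sum>k=1..N. d k * (cmod (w $ e k))\<^sup>2)"
proof -
  have "(w v* diagonal d) $ e k = of_real (d k) * w $ e k" if "k \<in> {1..N}" for k
  proof -
    have "(w v* diagonal d) $ e k = (\<Sum>i=1..N. if i = k then of_real (d k) * w $ e k else 0)"
      unfolding vector_matrix_mult_def sum_UNIV_e vec_lambda_beta
      by (rule sum.cong) (use that in \<open>auto simp: diagonal_entry\<close>)
    then show ?thesis using that by simp
  qed
  then show ?thesis
    by (simp add: quad_form_def sum_UNIV_e complex_norm_square mult.assoc del: of_real_power)
qed

text \<open>
  The exponential is lower triangular with unit diagonal, so the components of \<open>w\<close> vanish one after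
  the other, from the last to the first.
\<close>

lemma vector_exp_A_eq_0:
  assumes "w v* matrix_exp (x *\<^sub>R A_matrix N e a) = 0"
  shows "w = 0"
proof -
  have "w $ e i = 0" if "i \<in> {1..N}" for i
    using that
  proof (induction "N - i" arbitrary: i rule: less_induct)
    case less
    have "0 = (\<Sum>k=1..N. w $ e k * matrix_exp (x *\<^sub>R A_matrix N e a) $ e k $ e i)"
      using arg_cong[OF assms, of "\<lambda>v. v $ e i"] by (simp add: vector_matrix_mult_def sum_UNIV_e)
    also have "\<dots> = (\<Sum>k=1..N. if k = i then w $ e i else 0)"
    proof (intro sum.cong refl)
      fix k assume k: "k \<in> {1..N}"
      consider "k < i" | "k = i" | "i < k" by linarith
      then show "w $ e k * matrix_exp (x *\<^sub>R A_matrix N e a) $ e k $ e i = (if k = i then w $ e i else 0)"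
      proof cases
        case 3
        then have "w $ e k = 0" using less.hyps[of k] k by auto
        then show ?thesis using 3 by simp
      qed (use less.prems k in \<open>auto simp: exp_A_entry exp_coeff_def\<close>)
    qed
    also have "\<dots> = w $ e i" using less.prems by simp
    finally show ?case by simp
  qed
  then have "w $ p = 0" for p by (metis e_cases)
  then show ?thesis by (simp add: vec_eq_iff)
qed

text \<open>
  The diagonal factor of the weight exhibits \<open>w P(x) W(x) P(x)\<^sup>* w\<^sup>*\<close> as a sum of squares with
  coefficients that are positive for \<open>x > 0\<close>. If \<open>w X = 0\<close> the integral of this nonnegative function
  is zero, so for almost every \<open>x > 0\<close> it vanishes and with it the row \<open>w P(x)\<close>.
\<close>

lemma invertible_weighted_norm:
  assumes "\<nu> > 0" "\<And>k. 1 \<le> k \<Longrightarrow> k \<le> N \<Longrightarrow> \<delta> k > 0" "matrix_monic p n"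
    and X: "has_bochner_integral lborel
      (\<lambda>x. indicator {0..} x *\<^sub>R (matrix_poly p x ** W_weight N e a \<nu> \<delta> x ** ctranspose (matrix_poly p x))) X"
  shows "invertible X"
proof -
  have "w = 0" if "w v* X = 0" for w
  proof (rule monic_row_eq_0[OF assms(3)])
    define y where "y x = (w v* matrix_poly p x) v* matrix_exp (x *\<^sub>R A_matrix N e a)" for x
    define d where "d x k = exp (- x) * (\<delta> k * x powr (\<nu> + real k))" for x k
    define f where "f x = indicator {0..} x * (\<Sum>k=1..N. d x k * (cmod (y x $ e k))\<^sup>2)" for x :: real
    have "Re (quad_form (indicator {0..} x *\<^sub>R
        (matrix_poly p x ** W_weight N e a \<nu> \<delta> x ** ctranspose (matrix_poly p x))) w) = f x" for x
    proof -
      have "quad_form (matrix_poly p x ** W_weight N e a \<nu> \<delta> x ** ctranspose (matrix_poly p x)) w =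
          of_real (\<Sum>k=1..N. d x k * (cmod (y x $ e k))\<^sup>2)"
        unfolding quad_form_congruence W_weight_altdef T_weight_altdef quad_form_diagonal
        by (simp add: y_def d_def)
      then show ?thesis
        unfolding linear_cmul[OF bounded_linear.linear[OF bounded_linear_Re_quad_form]] f_def
        by simp
    qed
    with has_bochner_integral_bounded_linear[OF bounded_linear_Re_quad_form X, of w]
    have "has_bochner_integral lborel f (Re (quad_form X w))" by simp
    moreover have "quad_form X w = 0" using that by (simp add: quad_form_def)
    ultimately have f: "has_bochner_integral lborel f 0" by simp
    have d: "0 < d x k" if "k \<in> {1..N}" "0 < x" for x k
      using that assms(2) by (simp add: d_def)
    have d0: "0 \<le> d x k" if "k \<in> {1..N}" for x k
      using that assms(2)[of k] by (simp add: d_def less_imp_le)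
    have "0 \<le> f x" for x
      unfolding f_def by (intro mult_nonneg_nonneg sum_nonneg d0) auto
    then have "AE x in lborel. f x = 0"
      using f integral_nonneg_eq_0_iff_AE[of lborel f] by (simp add: has_bochner_integral_iff)
    then show "AE x in lborel. 0 < x \<longrightarrow> w v* matrix_poly p x = 0"
    proof eventually_elim
      case (elim x)
      show ?case
      proof
        assume x: "0 < x"
        then have "(\<Sum>k=1..N. d x k * (cmod (y x $ e k))\<^sup>2) = 0" using elim by (simp add: f_def)
        then have "\<forall>k\<in>{1..N}. d x k * (cmod (y x $ e k))\<^sup>2 = 0"
          by (subst (asm) sum_nonneg_eq_0_iff) (auto intro!: mult_nonneg_nonneg d0)
        then have "y x $ e k = 0" if "k \<in> {1..N}" for k
          using d[OF that x] that by fastforce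
        then have "y x $ q = 0" for q by (metis e_cases)
        then have "y x = 0" by (simp add: vec_eq_iff)
        then show "w v* matrix_poly p x = 0"
          unfolding y_def by (rule vector_exp_A_eq_0)
      qed
    qed
  qed
  then have "invertible (transpose X)"
    unfolding invertible_left_inverse matrix_left_invertible_ker by simp
  then show ?thesis by (simp only: invertible_transpose)
qed

end

section \<open>The recursion for the squared norms\<close>

theorem proposition6p14:
  fixes N :: nat and e :: "nat \<Rightarrow> 'n::finite"
    and \<nu> :: real and a \<delta> :: "nat \<Rightarrow> real"
    and P :: "nat \<Rightarrow> (complex ^ 'n ^ 'n) poly"
    and H :: "nat \<Rightarrow> complex ^ 'n ^ 'n"
    and A J :: "complex ^ 'n ^ 'n"
  assumes "1 \<le> N" and "bij_betw e {1..N} (UNIV :: 'n set)"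
    and "\<nu> > 0" and "\<And>k. 1 \<le> k \<Longrightarrow> k \<le> N \<Longrightarrow> \<delta> k > 0"
    and "A = A_matrix N e a" and "J = J_matrix N e"
    and "monic_orthogonal (W_weight N e a \<nu> \<delta>) P H"
  shows "(\<forall>n\<ge>1. H (n + 2) =
            matrix_power (matrix_inv (A - mat 1)) 2 **
            ((- commutator J (H n ** J ** matrix_inv (H n))
              - H n ** (transpose A - mat 1) ** matrix_inv (H (n - 1)) ** (A - mat 1)
              + (A - mat 1) ** H (n + 1) ** (transpose A - mat 1) ** matrix_inv (H n)) ** (A - mat 1)
             - mat 2
             - H (n + 1) ** J ** matrix_inv (H (n + 1))
             + H n ** J ** matrix_inv (H n)
             + (A - mat 1) ** commutator J (H (n + 1) ** J ** matrix_inv (H (n + 1)))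
             + (A - mat 1) ** H (n + 1) ** (transpose A - mat 1) ** matrix_inv (H n) ** (A - mat 1))
            ** H (n + 1) ** matrix_inv (transpose A - mat 1))
       \<and> (\<forall>i\<in>{1..N}. \<forall>j\<in>{1..N}. H 0 $ e i $ e j =
            complex_of_real (Gamma \<nu> *
              (\<Sum>r=1..min i j. \<delta> r / (fact (i - r) * fact (j - r))
                 * (\<Prod>k\<in>{r..<i}. a k) * (\<Prod>s\<in>{r..<j}. a s)
                 * pochhammer \<nu> (i + j - r + 1))))"
proof -
  interpret enumerated N e using assms(2) by unfold_locales
  define \<mu> where "\<mu> = moment \<nu> a \<delta>"
  define L where "L = A - mat 1"
  define M where "M = transpose A - mat 1"
  have monic_P: "matrix_monic (P n) n" for n
    using assms(7) by (simp add: monic_orthogonal_def)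
  then have P: "degree (P n) = n" "coeff (P n) n = mat 1" for n
    by (auto simp: matrix_monic_def)
  note integral = has_bochner_integral_weighted[OF assms(3), of "P n" a \<delta> "P m" for n m,
      unfolded P, folded \<mu>_def]
  have orth: "(\<Sum>i\<le>n. \<Sum>j\<le>m. coeff (P n) i ** \<mu> (i + j) ** ctranspose (coeff (P m) j)) =
      (if n = m then H n else 0)" for n m
  proof -
    have "(LINT x:{0..}|lborel. matrix_poly (P n) x ** W_weight N e a \<nu> \<delta> x ** ctranspose (matrix_poly (P m) x))
        = (if n = m then H n else 0)"
      using assms(7) by (simp add: monic_orthogonal_def)
    then show ?thesis
      unfolding set_lebesgue_integral_def has_bochner_integral_integral_eq[OF integral[of n m]] .
  qed
  interpret pearson \<mu> "\<lambda>n. coeff (P n)" "\<lambda>n j. ctranspose (coeff (P n) j)" H J L M \<nu>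
    by unfold_locales
      (simp_all only: P ctranspose_mat_1 orth, simp_all only: \<mu>_def L_def M_def assms(5,6)
        moment_pearson_left[OF assms(3)] moment_pearson_right[OF assms(3)])

  have "invertible (H n)" for n
    by (rule invertible_weighted_norm[OF assms(3,4) monic_P[of n]])
      (use integral[of n n] orth[of n n] in simp_all)
  then have H_inv: "H n ** matrix_inv (H n) = mat 1" "matrix_inv (H n) ** H n = mat 1" for n
    by (simp_all add: matrix_inv_eq)
  have "invertible L" unfolding L_def assms(5) by (rule invertible_A_minus_1)
  then have L_inv: "matrix_inv L ** L = mat 1" by (rule matrix_inv_eq)
  have "transpose L = M"
    by (simp add: L_def M_def transpose_def mat_def vec_eq_iff)
  with \<open>invertible L\<close> have "invertible M" using invertible_transpose by blast
  then have M_inv: "M ** matrix_inv M = mat 1" by (rule matrix_inv_eq)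

  \<comment> \<open>For \<open>n = 0\<close> truncation makes \<open>X 0\<close> the leading coefficient; the relations concern \<open>n \<ge> 1\<close>.\<close>
  define X where "X n = coeff (P n) (n - 1)" for n
  define \<Phi> where "\<Phi> n = H n ** J ** matrix_inv (H n)" for n
  define K where "K n = H n ** M ** matrix_inv (H (n - 1))" for n

  have left: "L ** X (n + 1) - X n ** L = (2 * real n + 1 + \<nu>) *\<^sub>R mat 1 + \<Phi> n" if "n \<ge> 1" for n
  proof -
    from that obtain p where n: "n = Suc p" by (cases n) auto
    show ?thesis
      using arg_cong[OF subleading_left[of p], of "\<lambda>Y. Y ** matrix_inv (H n)"]
      by (simp add: n X_def \<Phi>_def matrix_ring_simps H_inv)
  qed
  have right: "K n = X n + commutator J (X n)" if "n \<ge> 1" for n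
  proof -
    from that obtain p where n: "n = Suc p" by (cases n) auto
    show ?thesis
      using arg_cong[OF subleading_right[of p], of "\<lambda>Y. Y ** matrix_inv (H p)"]
      by (simp add: n X_def K_def matrix_ring_simps H_inv)
  qed
  have JL: "J ** L = L ** J + L + mat 1"
    using commutator_J_A[of a] by (simp add: L_def assms(5,6) commutator_def matrix_ring_simps algebra_simps)

  have recursion: "H (n + 2) = matrix_power (matrix_inv L) 2 **
      ((- commutator J (\<Phi> n) - K n ** L + L ** K (n + 1)) ** L - mat 2 - \<Phi> (n + 1) + \<Phi> n
        + L ** commutator J (\<Phi> (n + 1)) + L ** K (n + 1) ** L) ** H (n + 1) ** matrix_inv M"
    (is "_ = _ ** ?R ** _ ** _") if n: "n \<ge> 1" for n
  proof -
    have two: "mat 2 = 2 *\<^sub>R (mat 1 :: complex^'n^'n)"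
      by (simp add: mat_def vec_eq_iff scaleR_conv_of_real[where 'a = complex])
    have "L ** X (n + 2) - X (n + 1) ** L = (2 * real n + 1 + \<nu> + 2) *\<^sub>R mat 1 + \<Phi> (n + 1)"
      using left[of "n + 1"] by (simp add: algebra_simps)
    from elimination_identity[OF JL left[OF n] this right[OF n] right[of "n + 1"] right[of "n + 2"]]
    have R: "?R = L ** (L ** K (n + 2))" by (simp add: two)
    have "matrix_power (matrix_inv L) 2 ** ?R = matrix_inv L ** (matrix_inv L ** L) ** L ** K (n + 2)"
      unfolding R by (simp add: numeral_2_eq_2 matrix_mul_assoc)
    then have "matrix_power (matrix_inv L) 2 ** ?R = K (n + 2)" by (simp add: L_inv)
    moreover have "K (n + 2) ** H (n + 1) ** matrix_inv M = H (n + 2)"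
      by (simp add: K_def matrix_ring_simps H_inv M_inv)
    ultimately show ?thesis by simp
  qed
  have H0: "H 0 = moment \<nu> a \<delta> 0"
    using orth[of 0 0] P[of 0] by (simp add: ctranspose_mat_1 \<mu>_def)
  show ?thesis
    using recursion moment_0_entry[OF _ _ assms(3)]
    by (simp add: H0 L_def M_def \<Phi>_def K_def matrix_mul_assoc)
qed

end
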